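(* Let $\lambda\in\mathbb{Q}\cap\,]0,1]$ and let $E$ be a $[\lambda]$-primitive fresco. Then the principal Jordan-Hölder sequence of $E$ is unique.
   Context: $\tilde{\mathcal A}$ is the $\mathbb{C}$-algebra of formal series $\sum_{\nu\ge 0}P_\nu(a)b^\nu$, $P_\nu\in\mathbb{C}[x]$, with $ab-ba=b^2$, left and right multiplication by $a$ being continuous for the $b$-adic filtration. An (a,b)-module is a left $\tilde{\mathcal A}$-module free of finite rank over $\mathbb{C}[[b]]$; submodule means left $\tilde{\mathcal A}$-submodule. It has a simple pole if $aE\subset bE$; then its Bernstein polynomial is the minimal polynomial of $-b^{-1}a$ on $E/bE$. It is regular if it embeds in a simple pole (a,b)-module; its Bernstein polynomial is then that of its saturation $E^\sharp$ by $b^{-1}a$. It is geometric if regular with all roots of the Bernstein polynomial rational and strictly negative. A fresco is a geometric (a,b)-module generated by one element over $\tilde{\mathcal A}$. A regular (a,b)-module is $[\lambda]$-primitive if all roots of its Bernstein polynomial lie in $-\lambda+\mathbb{Z}$. A submodule $F\subset E$ is normal if $F\cap bE=bF$. For $\mu\in\mathbb{C}$, $E_\mu:=\tilde{\mathcal A}/\tilde{\mathcal A}(a-\mu b)$; every regular rank 1 (a,b)-module is isomorphic to exactly one $E_\mu$. A Jordan-Hölder (J-H.) sequence of a rank $k$ regular (a,b)-module $E$ is a sequence $0=F_0\subset F_1\subset\dots\subset F_k=E$ of normal submodules with each $F_j/F_{j-1}$ of rank 1, so $F_j/F_{j-1}\simeq E_{\lambda_j}$ for numbers $\lambda_1,\dots,\lambda_k$.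 For a $[\lambda]$-primitive fresco, a J-H. sequence is principal if $j\mapsto\lambda_j+j$ is non decreasing on $[1,k]$ (it is known that such a sequence exists). *)

theory Defs
  imports
    "HOL-Algebra.Module"
    "HOL-Algebra.AbelCoset"
    "HOL-Computational_Algebra.Polynomial"
    "HOL-Computational_Algebra.Formal_Power_Series"
    Complex_Main
begin

section \<open>The algebra generated by \<open>a\<close> and \<open>b\<close>\<close>

text \<open>
  The series with coefficients \<open>P\<^sub>0, P\<^sub>1, \<dots>\<close> stands for the sum of the \<open>P\<^sub>\<nu>(a) b\<^sup>\<nu>\<close>, with the
  coefficients on the left. Only the additive structure of the library type is used: the
  commutative product of power series is not the product of the algebra.
\<close>

type_synonym ab_series = "complex poly fps"

text \<open>
  From \<open>a b - b a = b\<^sup>2\<close> one gets \<open>b\<^sup>i a = a b\<^sup>i - i b\<^sup>i\<^sup>+\<^sup>1\<close>, hence \<open>b\<^sup>i Q(a)\<close> is the sum over \<open>j\<close> of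
  \<open>binom(-i, j) Q\<^sup>(\<^sup>j\<^sup>)(a) b\<^sup>i\<^sup>+\<^sup>j\<close>. The product below is the \<open>b\<close>-adically continuous extension.
\<close>

definition ab_mult :: "ab_series \<Rightarrow> ab_series \<Rightarrow> ab_series" where
  "ab_mult u v = Abs_fps (\<lambda>n. \<Sum>i\<le>n. \<Sum>j\<le>n - i.
     Polynomial.smult ((- of_nat i) gchoose j)
       (fps_nth u i * (pderiv ^^ j) (fps_nth v (n - i - j))))"

definition ab_algebra :: "ab_series ring" where
  "ab_algebra = \<lparr>carrier = UNIV, monoid.mult = ab_mult, one = 1, zero = 0, add = (+)\<rparr>"

definition a_elt :: ab_series where
  "a_elt = fps_const [:0, 1:]"

text \<open>The inclusion of the ring of power series in \<open>b\<close>, and in particular of the scalars.\<close>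

definition b_series :: "complex fps \<Rightarrow> ab_series" where
  "b_series s = Abs_fps (\<lambda>n. [:fps_nth s n:])"

definition b_elt :: ab_series where
  "b_elt = b_series fps_X"

definition scalar :: "complex \<Rightarrow> ab_series" where
  "scalar c = b_series (fps_const c)"

subsection \<open>Ring axioms and the commutation relation\<close>

lemma fps_nth_ab_mult:
  "fps_nth (ab_mult u v) n = (\<Sum>i\<le>n. \<Sum>j\<le>n - i. Polynomial.smult ((- of_nat i) gchoose j)
       (fps_nth u i * (pderiv ^^ j) (fps_nth v (n - i - j))))"
  by (simp add: ab_mult_def)

lemma ab_mult_add_left: "ab_mult (u + u') v = ab_mult u v + ab_mult u' v"
  by (simp add: fps_eq_iff fps_nth_ab_mult algebra_simps smult_add_right sum.distrib)

lemma ab_mult_add_right: "ab_mult u (v + v') = ab_mult u v + ab_mult u v'"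
  by (simp add: fps_eq_iff fps_nth_ab_mult algebra_simps smult_add_right sum.distrib higher_pderiv_add)

lemma ab_mult_zero [simp]: "ab_mult 0 v = 0" "ab_mult u 0 = 0"
  by (simp_all add: fps_eq_iff fps_nth_ab_mult)

lemma ab_mult_sum_left: "ab_mult (sum f A) v = (\<Sum>x\<in>A. ab_mult (f x) v)"
  by (induction A rule: infinite_finite_induct) (simp_all add: ab_mult_add_left)

lemma ab_mult_sum_right: "ab_mult u (sum f A) = (\<Sum>x\<in>A. ab_mult u (f x))"
  by (induction A rule: infinite_finite_induct) (simp_all add: ab_mult_add_right)

definition ab_monom :: "complex poly \<Rightarrow> nat \<Rightarrow> ab_series" where
  "ab_monom p i = Abs_fps (\<lambda>n. if n = i then p else 0)"

lemma nth_ab_monom: "fps_nth (ab_monom p i) n = (if n = i then p else 0)"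
  by (simp add: ab_monom_def)

lemma nth_monom_mult:
  "fps_nth (ab_mult (ab_monom p i) v) n = (if i \<le> n then
     \<Sum>j\<le>n - i. Polynomial.smult ((- of_nat i) gchoose j) (p * (pderiv ^^ j) (fps_nth v (n - i - j))) else 0)"
proof -
  have "fps_nth (ab_mult (ab_monom p i) v) n = (\<Sum>i'\<le>n. if i' = i then \<Sum>j\<le>n - i. Polynomial.smult ((- of_nat i) gchoose j) (p * (pderiv ^^ j) (fps_nth v (n - i - j))) else 0)"
    unfolding fps_nth_ab_mult by (rule sum.cong) (auto simp: ab_monom_def)
  thus ?thesis by simp
qed

lemma nth_monom_monom:
  "fps_nth (ab_mult (ab_monom p i) (ab_monom q k)) n = (if i + k \<le> n then
     Polynomial.smult ((- of_nat i) gchoose (n - i - k)) (p * (pderiv ^^ (n - i - k)) q) else 0)"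
proof -
  have "fps_nth (ab_mult (ab_monom p i) (ab_monom q k)) n = (if i \<le> n then
     \<Sum>j\<le>n - i. (if j = n - i - k \<and> i + k \<le> n then Polynomial.smult ((- of_nat i) gchoose (n - i - k)) (p * (pderiv ^^ (n - i - k)) q) else 0) else 0)"
    unfolding nth_monom_mult
    by (intro if_cong refl sum.cong) (auto simp: ab_monom_def)
  also have "\<dots> = (if i + k \<le> n then
     Polynomial.smult ((- of_nat i) gchoose (n - i - k)) (p * (pderiv ^^ (n - i - k)) q) else 0)"
    by (cases "i + k \<le> n") auto
  finally show ?thesis .
qed

lemma higher_pderiv_mult_poly:
  fixes p q :: "complex poly"
  shows "(pderiv ^^ n) (p * q) = (\<Sum>s\<le>n. Polynomial.smult (of_nat (n choose s)) ((pderiv ^^ s) p * (pderiv ^^ (n - s)) q))"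
proof (induction n)
  case (Suc n)
  let ?f = "\<lambda>s t. (pderiv ^^ s) p * (pderiv ^^ t) q"
  have "(pderiv ^^ Suc n) (p * q) = (\<Sum>s\<le>n. Polynomial.smult (of_nat (n choose s)) (?f s (Suc n - s))) + (\<Sum>s\<le>n. Polynomial.smult (of_nat (n choose s)) (?f (Suc s) (n - s)))"
    by (simp add: Suc higher_pderiv_sum[of 1, simplified] pderiv_smult pderiv_mult smult_add_right sum.distrib Suc_diff_le mult.commute)
  also have "(\<Sum>s\<le>n. Polynomial.smult (of_nat (n choose s)) (?f s (Suc n - s))) = (\<Sum>s\<le>Suc n. Polynomial.smult (of_nat (n choose s)) (?f s (Suc n - s)))"
    by simp
  also have "\<dots> = ?f 0 (Suc n) + (\<Sum>s\<le>n. Polynomial.smult (of_nat (n choose Suc s)) (?f (Suc s) (n - s)))"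
    by (subst sum.atMost_Suc_shift) simp
  also have "\<dots> + (\<Sum>s\<le>n. Polynomial.smult (of_nat (n choose s)) (?f (Suc s) (n - s))) =
     ?f 0 (Suc n) + (\<Sum>s\<le>n. Polynomial.smult (of_nat (Suc n choose Suc s)) (?f (Suc s) (n - s)))"
    by (simp add: sum.distrib[symmetric] smult_add_left[symmetric] add.commute del: funpow.simps)
  also have "\<dots> = (\<Sum>s\<le>Suc n. Polynomial.smult (of_nat (Suc n choose s)) (?f s (Suc n - s)))"
    by (subst sum.atMost_Suc_shift) simp
  finally show ?case .
qed simp

lemma gbinomial_Vandermonde_shift:
  fixes x y :: complex
  assumes "s \<le> N"
  shows "(\<Sum>j\<le>N - s. (y gchoose j) * (x gchoose (N - j)) * of_nat ((N - j) choose s)) =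
    (x gchoose s) * ((x + y - of_nat s) gchoose (N - s))"
proof -
  have "(\<Sum>j\<le>N - s. (y gchoose j) * (x gchoose (N - j)) * of_nat ((N - j) choose s)) =
    (\<Sum>j\<le>N - s. (x gchoose s) * ((y gchoose j) * ((x - of_nat s) gchoose (N - s - j))))"
  proof (rule sum.cong, simp)
    fix j assume "j \<in> {..N - s}"
    hence j: "s \<le> N - j" using assms by auto
    have "(x gchoose (N - j)) * of_nat ((N - j) choose s) = (x gchoose s) * ((x - of_nat s) gchoose (N - j - s))"
      using gbinomial_trinomial_revision[OF j, of x] by (simp add: binomial_gbinomial)
    moreover have "N - j - s = N - s - j" by simp
    ultimately show "(y gchoose j) * (x gchoose (N - j)) * of_nat ((N - j) choose s) = (x gchoose s) * ((y gchoose j) * ((x - of_nat s) gchoose (N - s - j)))"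
      by (simp add: algebra_simps)
  qed
  also have "\<dots> = (x gchoose s) * ((x + y - of_nat s) gchoose (N - s))"
    using gbinomial_Vandermonde[of y "x - of_nat s" "N - s"]
    by (simp add: sum_distrib_left[symmetric] atLeast0AtMost algebra_simps)
  finally show ?thesis .
qed

lemma smult_sum_poly: "Polynomial.smult c (sum f A) = (\<Sum>x\<in>A. Polynomial.smult c (f x))"
  by (induction A rule: infinite_finite_induct) (simp_all add: smult_add_right)

lemma sum_triangle_swap:
  fixes f :: "nat \<Rightarrow> nat \<Rightarrow> 'c :: comm_monoid_add"
  shows "(\<Sum>s\<le>N. \<Sum>j\<le>N - s. f s j) = (\<Sum>j\<le>N. \<Sum>s\<le>N - j. f s j)"
proof -
  have "(\<Sum>s\<le>N. \<Sum>j\<le>N - s. f s j) = (\<Sum>(s, j)\<in>Sigma {..N} (\<lambda>s. {..N - s}). f s j)"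
    by (rule sum.Sigma) auto
  also have "\<dots> = (\<Sum>(j, s)\<in>Sigma {..N} (\<lambda>s. {..N - s}). f s j)"
    by (rule sum.reindex_bij_witness[of _ prod.swap prod.swap]) auto
  also have "\<dots> = (\<Sum>j\<le>N. \<Sum>s\<le>N - j. f s j)"
    by (rule sum.Sigma[symmetric]) auto
  finally show ?thesis .
qed

lemma monom_assoc:
  "ab_mult (ab_mult (ab_monom p i) (ab_monom q k)) (ab_monom r m) =
   ab_mult (ab_monom p i) (ab_mult (ab_monom q k) (ab_monom r m))"
proof (rule fps_ext)
  fix n
  show "fps_nth (ab_mult (ab_mult (ab_monom p i) (ab_monom q k)) (ab_monom r m)) n =
        fps_nth (ab_mult (ab_monom p i) (ab_mult (ab_monom q k) (ab_monom r m))) n"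
  proof (cases "i + k + m \<le> n")
    case False
    have "fps_nth (ab_mult (ab_mult (ab_monom p i) (ab_monom q k)) (ab_monom r m)) n = 0"
      unfolding fps_nth_ab_mult[of "ab_mult _ _"] using False
      by (intro sum.neutral ballI) (auto simp: nth_monom_monom nth_ab_monom)
    moreover have "fps_nth (ab_mult (ab_monom p i) (ab_mult (ab_monom q k) (ab_monom r m))) n = 0"
      unfolding nth_monom_mult[of p] using False
      by (auto intro!: sum.neutral simp: nth_monom_monom)
    ultimately show ?thesis by simp
  next
    case True
    define N where "N = n - i - k - m"
    let ?x = "- of_nat i :: complex" and ?y = "- of_nat k :: complex"
    let ?D = "\<lambda>s t. p * ((pderiv ^^ s) q * (pderiv ^^ t) r)"
    have n: "n = i + k + m + N" using True by (simp add: N_def)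
    have "fps_nth (ab_mult (ab_mult (ab_monom p i) (ab_monom q k)) (ab_monom r m)) n =
      (\<Sum>i'\<le>n. if i' \<le> n - m then Polynomial.smult ((- of_nat i') gchoose (n - i' - m))
         (fps_nth (ab_mult (ab_monom p i) (ab_monom q k)) i' * (pderiv ^^ (n - i' - m)) r) else 0)"
      unfolding fps_nth_ab_mult[of "ab_mult _ _"]
    proof (rule sum.cong, simp)
      fix i' assume "i' \<in> {..n}"
      have "(\<Sum>j\<le>n - i'. Polynomial.smult ((- of_nat i') gchoose j)
         (fps_nth (ab_mult (ab_monom p i) (ab_monom q k)) i' * (pderiv ^^ j) (fps_nth (ab_monom r m) (n - i' - j)))) =
         (\<Sum>j\<le>n - i'. if j = n - i' - m \<and> i' \<le> n - m then Polynomial.smult ((- of_nat i') gchoose (n - i' - m))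
         (fps_nth (ab_mult (ab_monom p i) (ab_monom q k)) i' * (pderiv ^^ (n - i' - m)) r) else 0)"
        using \<open>i' \<in> {..n}\<close> n by (intro sum.cong) (auto simp: ab_monom_def)
      thus "(\<Sum>j\<le>n - i'. Polynomial.smult ((- of_nat i') gchoose j)
         (fps_nth (ab_mult (ab_monom p i) (ab_monom q k)) i' * (pderiv ^^ j) (fps_nth (ab_monom r m) (n - i' - j)))) =
         (if i' \<le> n - m then Polynomial.smult ((- of_nat i') gchoose (n - i' - m))
         (fps_nth (ab_mult (ab_monom p i) (ab_monom q k)) i' * (pderiv ^^ (n - i' - m)) r) else 0)"
        by (cases "i' \<le> n - m") auto
    qed
    also have "\<dots> = (\<Sum>i'\<in>{i+k..i+k+N}. Polynomial.smult ((- of_nat i') gchoose (n - i' - m))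
         (fps_nth (ab_mult (ab_monom p i) (ab_monom q k)) i' * (pderiv ^^ (n - i' - m)) r))"
      by (rule sum.mono_neutral_cong_right) (auto simp: n nth_monom_monom)
    also have "\<dots> = (\<Sum>s\<le>N. Polynomial.smult ((?x gchoose s) * ((?x + ?y - of_nat s) gchoose (N - s))) (?D s (N - s)))"
    proof (rule sum.reindex_bij_witness[of _ "\<lambda>s. i + k + s" "\<lambda>i'. i' - (i + k)"], goal_cases)
      case (5 i')
      define s where "s = i' - (i + k)"
      have i': "i' = i + k + s" using 5 by (simp add: s_def)
      have e: "n - i' - m = N - s" using i' n by simp
      have e2: "(- of_nat i' :: complex) = ?x + ?y - of_nat s" by (simp add: i')
      have e3: "i' - i - k = s" using i' by simp
      show ?case
        unfolding e e2 s_def[symmetric] nth_monom_monom e3 using i' by (simp add: mult_ac)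
    qed auto
    also have "\<dots> = (\<Sum>s\<le>N. \<Sum>j\<le>N - s. Polynomial.smult ((?y gchoose j) * (?x gchoose (N - j)) * of_nat ((N - j) choose s)) (?D s (N - s)))"
      by (rule sum.cong, simp, subst gbinomial_Vandermonde_shift[symmetric]) (simp_all add: smult_sum)
    also have "\<dots> = (\<Sum>j\<le>N. \<Sum>s\<le>N - j. Polynomial.smult ((?y gchoose j) * (?x gchoose (N - j)) * of_nat ((N - j) choose s)) (?D s (N - s)))"
      by (rule sum_triangle_swap)
    also have "\<dots> = (\<Sum>j\<le>N. Polynomial.smult (?x gchoose (N - j)) (p * (pderiv ^^ (N - j)) (Polynomial.smult (?y gchoose j) (q * (pderiv ^^ j) r))))"
    proof (rule sum.cong, simp)
      fix j assume j: "j \<in> {..N}"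
      have e: "(pderiv ^^ (N - (j + s))) ((pderiv ^^ j) r) = (pderiv ^^ (N - s)) r" if "s \<le> N - j" for s
      proof -
        have "N - s = (N - (j + s)) + j" using that j by auto
        thus ?thesis by (simp add: funpow_add)
      qed
      show "(\<Sum>s\<le>N - j. Polynomial.smult ((?y gchoose j) * (?x gchoose (N - j)) * of_nat ((N - j) choose s)) (?D s (N - s))) =
        Polynomial.smult (?x gchoose (N - j)) (p * (pderiv ^^ (N - j)) (Polynomial.smult (?y gchoose j) (q * (pderiv ^^ j) r)))"
        unfolding higher_pderiv_smult higher_pderiv_mult_poly
        by (simp add: sum_distrib_left smult_sum_poly e mult_ac)
    qed
    also have "\<dots> = (\<Sum>j\<le>n - i. Polynomial.smult (?x gchoose j) (p * (pderiv ^^ j) (fps_nth (ab_mult (ab_monom q k) (ab_monom r m)) (n - i - j))))"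
    proof -
      have "(\<Sum>j\<le>n - i. Polynomial.smult (?x gchoose j) (p * (pderiv ^^ j) (fps_nth (ab_mult (ab_monom q k) (ab_monom r m)) (n - i - j)))) =
        (\<Sum>j\<le>N. Polynomial.smult (?x gchoose j) (p * (pderiv ^^ j) (fps_nth (ab_mult (ab_monom q k) (ab_monom r m)) (n - i - j))))"
        by (rule sum.mono_neutral_right) (auto simp: n nth_monom_monom)
      also have "\<dots> = (\<Sum>j\<le>N. Polynomial.smult (?x gchoose (N - j)) (p * (pderiv ^^ (N - j)) (Polynomial.smult (?y gchoose j) (q * (pderiv ^^ j) r))))"
        by (rule sum.reindex_bij_witness[of _ "\<lambda>j. N - j" "\<lambda>j. N - j"]) (auto simp: nth_monom_monom n)
      finally show ?thesis by simp
    qed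
    also have "\<dots> = fps_nth (ab_mult (ab_monom p i) (ab_mult (ab_monom q k) (ab_monom r m))) n"
      unfolding nth_monom_mult using n by simp
    finally show ?thesis .
  qed
qed

definition ab_trunc :: "nat \<Rightarrow> ab_series \<Rightarrow> ab_series" where
  "ab_trunc n u = (\<Sum>i\<le>n. ab_monom (fps_nth u i) i)"

lemma nth_trunc: "fps_nth (ab_trunc n u) m = (if m \<le> n then fps_nth u m else 0)"
  by (simp add: ab_trunc_def fps_sum_nth ab_monom_def)

lemma ab_mult_cong:
  assumes "\<And>i. i \<le> n \<Longrightarrow> fps_nth u i = fps_nth u' i" "\<And>i. i \<le> n \<Longrightarrow> fps_nth v i = fps_nth v' i" "m \<le> n"
  shows "fps_nth (ab_mult u v) m = fps_nth (ab_mult u' v') m"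
  unfolding fps_nth_ab_mult by (intro sum.cong refl arg_cong2[of _ _ _ _ Polynomial.smult] arg_cong2[of _ _ _ _ times] arg_cong[of _ _ "pderiv ^^ _"]) (use assms in auto)

lemma ab_mult_assoc: "ab_mult (ab_mult u v) w = ab_mult u (ab_mult v w)"
proof (rule fps_ext)
  fix n
  let ?t = "ab_trunc n"
  have "fps_nth (ab_mult (ab_mult u v) w) n = fps_nth (ab_mult (ab_mult (?t u) (?t v)) (?t w)) n"
    by (rule ab_mult_cong[of n], rule ab_mult_cong[of n]) (auto simp: nth_trunc)
  also have "ab_mult (ab_mult (?t u) (?t v)) (?t w) = ab_mult (?t u) (ab_mult (?t v) (?t w))"
    by (simp add: ab_trunc_def ab_mult_sum_left ab_mult_sum_right monom_assoc)
  also have "fps_nth \<dots> n = fps_nth (ab_mult u (ab_mult v w)) n"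
    by (rule ab_mult_cong[of n], simp add: nth_trunc, rule ab_mult_cong[of n]) (auto simp: nth_trunc)
  finally show "fps_nth (ab_mult (ab_mult u v) w) n = fps_nth (ab_mult u (ab_mult v w)) n" .
qed

lemma ab_monom_1: "1 = ab_monom 1 0" and a_elt_monom: "a_elt = ab_monom [:0,1:] 0" and b_elt_monom: "b_elt = ab_monom 1 1"
  by (auto simp: fps_eq_iff ab_monom_def a_elt_def b_elt_def b_series_def)

lemma ab_mult_1_left: "ab_mult 1 v = v"
proof (rule fps_ext)
  fix n
  have "fps_nth (ab_mult 1 v) n = (\<Sum>j\<le>n. if j = 0 then fps_nth v n else 0)"
    unfolding ab_monom_1 nth_monom_mult 
    by (simp only: le0 if_True minus_nat.diff_0, rule sum.cong) (auto simp: gbinomial_0_left)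
  thus "fps_nth (ab_mult 1 v) n = fps_nth v n" by simp
qed

lemma ab_mult_1_right: "ab_mult u 1 = u"
proof (rule fps_ext)
  fix n
  have *: "(\<Sum>j\<le>n - i. Polynomial.smult ((- of_nat i) gchoose j) (fps_nth u i * (pderiv ^^ j) (fps_nth 1 (n - i - j)))) = (if i = n then fps_nth u n else 0)" if "i \<le> n" for i
  proof (cases "i = n")
    case False
    have "(pderiv ^^ j) (fps_nth (1::ab_series) (n - i - j)) = 0" if "j \<le> n - i" for j
      using False that \<open>i \<le> n\<close> by (cases j) (auto simp: fps_one_nth simp del: funpow.simps simp add: funpow_Suc_right)
    thus ?thesis using False by (auto intro!: sum.neutral)
  qed auto
  show "fps_nth (ab_mult u 1) n = fps_nth u n"
    unfolding fps_nth_ab_mult using * by simp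
qed

lemma ring_ab_algebra: "ring ab_algebra"
proof (rule ringI)
  show "abelian_group ab_algebra"
  proof (rule abelian_groupI)
    fix x assume "x \<in> carrier ab_algebra"
    show "\<exists>y\<in>carrier ab_algebra. y \<oplus>\<^bsub>ab_algebra\<^esub> x = \<zero>\<^bsub>ab_algebra\<^esub>"
      by (rule bexI[of _ "- x"]) (simp_all add: ab_algebra_def)
  qed (auto simp: ab_algebra_def)
  show "monoid ab_algebra"
    by (rule monoidI) (auto simp: ab_algebra_def ab_mult_assoc ab_mult_1_left ab_mult_1_right)
qed (auto simp: ab_algebra_def ab_mult_add_left ab_mult_add_right)

lemma ab_commutation:
  "a_elt \<otimes>\<^bsub>ab_algebra\<^esub> b_elt \<ominus>\<^bsub>ab_algebra\<^esub> b_elt \<otimes>\<^bsub>ab_algebra\<^esub> a_elt = b_elt \<otimes>\<^bsub>ab_algebra\<^esub> b_elt"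
proof -
  interpret ring ab_algebra by (rule ring_ab_algebra)
  have "ab_mult a_elt b_elt = ab_mult b_elt b_elt + ab_mult b_elt a_elt"
  proof (rule fps_ext)
    fix n
    consider "n = 0" | "n = 1" | "n = 2" | k where "n = Suc (Suc (Suc k))"
      by (metis One_nat_def Suc_1 not0_implies_Suc)
    thus "fps_nth (ab_mult a_elt b_elt) n = fps_nth (ab_mult b_elt b_elt + ab_mult b_elt a_elt) n"
      by cases (auto simp: a_elt_monom b_elt_monom nth_monom_monom pderiv_pCons gbinomial_0_left
          funpow_Suc_right simp del: funpow.simps)
  qed
  hence "a_elt \<otimes>\<^bsub>ab_algebra\<^esub> b_elt = b_elt \<otimes>\<^bsub>ab_algebra\<^esub> b_elt \<oplus>\<^bsub>ab_algebra\<^esub> b_elt \<otimes>\<^bsub>ab_algebra\<^esub> a_elt"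
    by (simp add: ab_algebra_def)
  moreover have "x \<in> carrier ab_algebra" for x
    by (simp add: ab_algebra_def)
  ultimately show ?thesis
    by (metis add.inv_solve_right' a_minus_def m_closed)
qed


section \<open>Left modules over a ring\<close>

text \<open>The library locale \<open>module\<close> is restricted to commutative rings.\<close>

locale left_module = R?: ring R + M?: abelian_group M for R (structure) and M (structure) +
  assumes smult_closed [simp, intro]:
      "\<lbrakk>r \<in> carrier R; x \<in> carrier M\<rbrakk> \<Longrightarrow> r \<odot>\<^bsub>M\<^esub> x \<in> carrier M"
    and smult_l_distr:
      "\<lbrakk>r \<in> carrier R; s \<in> carrier R; x \<in> carrier M\<rbrakk> \<Longrightarrow>
        (r \<oplus> s) \<odot>\<^bsub>M\<^esub> x = r \<odot>\<^bsub>M\<^esub> x \<oplus>\<^bsub>M\<^esub> s \<odot>\<^bsub>M\<^esub> x"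
    and smult_r_distr:
      "\<lbrakk>r \<in> carrier R; x \<in> carrier M; y \<in> carrier M\<rbrakk> \<Longrightarrow>
        r \<odot>\<^bsub>M\<^esub> (x \<oplus>\<^bsub>M\<^esub> y) = r \<odot>\<^bsub>M\<^esub> x \<oplus>\<^bsub>M\<^esub> r \<odot>\<^bsub>M\<^esub> y"
    and smult_assoc:
      "\<lbrakk>r \<in> carrier R; s \<in> carrier R; x \<in> carrier M\<rbrakk> \<Longrightarrow>
        (r \<otimes> s) \<odot>\<^bsub>M\<^esub> x = r \<odot>\<^bsub>M\<^esub> (s \<odot>\<^bsub>M\<^esub> x)"
    and smult_one [simp]: "x \<in> carrier M \<Longrightarrow> \<one> \<odot>\<^bsub>M\<^esub> x = x"

definition lmod_hom ::
    "('r, 'm) ring_scheme \<Rightarrow> ('r, 'e) module \<Rightarrow> ('r, 'f) module \<Rightarrow> ('e \<Rightarrow> 'f) set" where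
  "lmod_hom R M N = {f \<in> carrier M \<rightarrow> carrier N.
     (\<forall>x\<in>carrier M. \<forall>y\<in>carrier M. f (x \<oplus>\<^bsub>M\<^esub> y) = f x \<oplus>\<^bsub>N\<^esub> f y) \<and>
     (\<forall>r\<in>carrier R. \<forall>x\<in>carrier M. f (r \<odot>\<^bsub>M\<^esub> x) = r \<odot>\<^bsub>N\<^esub> f x)}"

definition lmod_iso ::
    "('r, 'm) ring_scheme \<Rightarrow> ('r, 'e) module \<Rightarrow> ('r, 'f) module \<Rightarrow> bool" where
  "lmod_iso R M N \<longleftrightarrow> (\<exists>f \<in> lmod_hom R M N. bij_betw f (carrier M) (carrier N))"

text \<open>The fields \<open>mult\<close> and \<open>one\<close> of a module record carry no meaning.\<close>

definition quot_lmod :: "('r, 'e) module \<Rightarrow> 'e set \<Rightarrow> ('r, 'e set) module" where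
  "quot_lmod M N = \<lparr>carrier = a_rcosets\<^bsub>M\<^esub> N, monoid.mult = undefined, one = undefined,
     zero = N, add = set_add M,
     module.smult = (\<lambda>r X. \<Union>x\<in>X. N +>\<^bsub>M\<^esub> (r \<odot>\<^bsub>M\<^esub> x))\<rparr>"

definition regular_lmod :: "'r ring \<Rightarrow> ('r, 'r) module" where
  "regular_lmod R = \<lparr>carrier = carrier R, monoid.mult = monoid.mult R, one = one R, zero = zero R,
     add = add R, module.smult = monoid.mult R\<rparr>"


section \<open>(a,b)-modules\<close>

definition b_basis :: "(ab_series, 'e) module \<Rightarrow> 'e set \<Rightarrow> bool" where
  "b_basis E B \<longleftrightarrow> finite B \<and> B \<subseteq> carrier E \<and>
     (\<forall>x\<in>carrier E. \<exists>!c. c \<in> B \<rightarrow>\<^sub>E UNIV \<and> x = (\<Oplus>\<^bsub>E\<^esub>e\<in>B. b_series (c e) \<odot>\<^bsub>E\<^esub> e))"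

definition has_rank :: "(ab_series, 'e) module \<Rightarrow> nat \<Rightarrow> bool" where
  "has_rank E k \<longleftrightarrow> (\<exists>B. b_basis E B \<and> card B = k)"

definition ab_module :: "(ab_series, 'e) module \<Rightarrow> bool" where
  "ab_module E \<longleftrightarrow> left_module ab_algebra E \<and> (\<exists>k. has_rank E k)"

definition b_image :: "(ab_series, 'e) module \<Rightarrow> 'e set \<Rightarrow> 'e set" where
  "b_image E F = (\<lambda>x. b_elt \<odot>\<^bsub>E\<^esub> x) ` F"

definition normal_submodule :: "'e set \<Rightarrow> (ab_series, 'e) module \<Rightarrow> bool" where
  "normal_submodule F E \<longleftrightarrow>
     submodule F ab_algebra E \<and> F \<inter> b_image E (carrier E) = b_image E F"

definition simple_pole :: "(ab_series, 'e) module \<Rightarrow> bool" where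
  "simple_pole E \<longleftrightarrow> ab_module E \<and>
     (\<lambda>x. a_elt \<odot>\<^bsub>E\<^esub> x) ` carrier E \<subseteq> b_image E (carrier E)"

text \<open>
  The ambient module is looked for on one fixed type, which loses nothing: a free module of rank
  \<open>n\<close> over the power series in \<open>b\<close> can be transported to the functions vanishing outside \<open>{..<n}\<close>.
\<close>

definition regular :: "(ab_series, 'e) module \<Rightarrow> bool" where
  "regular E \<longleftrightarrow> ab_module E \<and>
     (\<exists>S :: (ab_series, nat \<Rightarrow> complex fps) module. simple_pole S \<and>
        (\<exists>f \<in> lmod_hom ab_algebra E S. inj_on f (carrier E)))"

definition E_mod :: "complex \<Rightarrow> (ab_series, ab_series set) module" where
  "E_mod \<mu> = quot_lmod (regular_lmod ab_algebra)
     ((\<lambda>u. u \<otimes>\<^bsub>ab_algebra\<^esub> (a_elt \<ominus>\<^bsub>ab_algebra\<^esub> scalar \<mu> \<otimes>\<^bsub>ab_algebra\<^esub> b_elt)) ` UNIV)"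


section \<open>Bernstein polynomials\<close>

subsection \<open>Simple pole case\<close>

definition binv_a :: "(ab_series, 'e) module \<Rightarrow> 'e \<Rightarrow> 'e" where
  "binv_a E x = (THE y. y \<in> carrier E \<and> b_elt \<odot>\<^bsub>E\<^esub> y = a_elt \<odot>\<^bsub>E\<^esub> x)"

definition mod_b :: "(ab_series, 'e) module \<Rightarrow> (ab_series, 'e set) module" where
  "mod_b E = quot_lmod E (b_image E (carrier E))"

text \<open>The endomorphism of \<open>E/bE\<close> induced by \<open>-b\<^sup>-\<^sup>1a\<close>.\<close>

definition residue_endo :: "(ab_series, 'e) module \<Rightarrow> 'e set \<Rightarrow> 'e set" where
  "residue_endo E X = (\<Union>x\<in>X. b_image E (carrier E) +>\<^bsub>E\<^esub> (\<ominus>\<^bsub>E\<^esub> binv_a E x))"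

definition annihilates ::
    "(ab_series, 'e) module \<Rightarrow> ('e \<Rightarrow> 'e) \<Rightarrow> complex poly \<Rightarrow> bool" where
  "annihilates V T p \<longleftrightarrow> (\<forall>x\<in>carrier V.
     (\<Oplus>\<^bsub>V\<^esub>i\<in>{..degree p}. scalar (coeff p i) \<odot>\<^bsub>V\<^esub> (T ^^ i) x) = \<zero>\<^bsub>V\<^esub>)"

definition minimal_poly :: "(ab_series, 'e) module \<Rightarrow> ('e \<Rightarrow> 'e) \<Rightarrow> complex poly" where
  "minimal_poly V T = (THE p. lead_coeff p = 1 \<and> annihilates V T p \<and>
     (\<forall>q. q \<noteq> 0 \<and> annihilates V T q \<longrightarrow> degree p \<le> degree q))"

definition bernstein_simple :: "(ab_series, 'e) module \<Rightarrow> complex poly" where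
  "bernstein_simple E = minimal_poly (mod_b E) (residue_endo E)"

subsection \<open>Saturation\<close>

text \<open>
  \<open>E[b\<^sup>-\<^sup>1]\<close>, with \<open>b_frac E x m\<close> representing \<open>b\<^sup>-\<^sup>mx\<close>. The element \<open>u\<close> acts by
  \<open>u b\<^sup>-\<^sup>mx = b\<^sup>-\<^sup>m(b\<^sup>mub\<^sup>-\<^sup>m)x\<close>, where \<open>b\<^sup>mub\<^sup>-\<^sup>m\<close> is in the algebra since \<open>b\<^sup>mu\<close> is divisible by \<open>b\<^sup>m\<close>
  on the right; as coefficients stand on the left, that division is a shift of indices.
\<close>

definition b_pow :: "nat \<Rightarrow> ab_series" where
  "b_pow m = b_series (fps_X ^ m)"

definition frac_rel :: "(ab_series, 'e) module \<Rightarrow> (('e \<times> nat) \<times> ('e \<times> nat)) set" where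
  "frac_rel E = {((x, m), (y, n)). x \<in> carrier E \<and> y \<in> carrier E \<and>
     b_pow n \<odot>\<^bsub>E\<^esub> x = b_pow m \<odot>\<^bsub>E\<^esub> y}"

definition b_frac :: "(ab_series, 'e) module \<Rightarrow> 'e \<Rightarrow> nat \<Rightarrow> ('e \<times> nat) set" where
  "b_frac E x m = frac_rel E `` {(x, m)}"

definition conj_b :: "nat \<Rightarrow> ab_series \<Rightarrow> ab_series" where
  "conj_b m u = fps_shift m (ab_mult (b_pow m) u)"

definition localization :: "(ab_series, 'e) module \<Rightarrow> (ab_series, ('e \<times> nat) set) module" where
  "localization E = \<lparr>carrier = (carrier E \<times> UNIV) // frac_rel E,
     monoid.mult = undefined, one = undefined, zero = b_frac E \<zero>\<^bsub>E\<^esub> 0,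
     add = (\<lambda>X Y. \<Union>(x, m)\<in>X. \<Union>(y, n)\<in>Y.
       b_frac E (b_pow n \<odot>\<^bsub>E\<^esub> x \<oplus>\<^bsub>E\<^esub> b_pow m \<odot>\<^bsub>E\<^esub> y) (m + n)),
     module.smult = (\<lambda>u X. \<Union>(x, m)\<in>X. b_frac E (conj_b m u \<odot>\<^bsub>E\<^esub> x) m)\<rparr>"

text \<open>The smallest submodule of \<open>E[b\<^sup>-\<^sup>1]\<close> that contains \<open>E\<close> and is stable under \<open>b\<^sup>-\<^sup>1a\<close>.\<close>

definition saturation :: "(ab_series, 'e) module \<Rightarrow> (ab_series, ('e \<times> nat) set) module" where
  "saturation E = (localization E)\<lparr>carrier := \<Inter>{S. submodule S ab_algebra (localization E) \<and>
     (\<lambda>x. b_frac E x 0) ` carrier E \<subseteq> S \<and> binv_a (localization E) ` S \<subseteq> S}\<rparr>"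

definition bernstein :: "(ab_series, 'e) module \<Rightarrow> complex poly" where
  "bernstein E = bernstein_simple (saturation E)"


section \<open>Frescos and Jordan-Hoelder sequences\<close>

definition geometric :: "(ab_series, 'e) module \<Rightarrow> bool" where
  "geometric E \<longleftrightarrow> regular E \<and>
     (\<forall>z. poly (bernstein E) z = 0 \<longrightarrow> (\<exists>q::rat. z = of_rat q \<and> q < 0))"

definition fresco :: "(ab_series, 'e) module \<Rightarrow> bool" where
  "fresco E \<longleftrightarrow> geometric E \<and>
     (\<exists>e\<in>carrier E. carrier E = (\<lambda>u. u \<odot>\<^bsub>E\<^esub> e) ` carrier ab_algebra)"

definition primitive :: "complex \<Rightarrow> (ab_series, 'e) module \<Rightarrow> bool" where
  "primitive l E \<longleftrightarrow> regular E \<and>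
     (\<forall>z. poly (bernstein E) z = 0 \<longrightarrow> (\<exists>n::int. z = - l + of_int n))"

text \<open>The sequence \<open>F\<close> is only relevant on \<open>{0..k}\<close>, \<open>k\<close> being the rank.\<close>

definition JH_quotient ::
    "(ab_series, 'e) module \<Rightarrow> (nat \<Rightarrow> 'e set) \<Rightarrow> nat \<Rightarrow> (ab_series, 'e set) module" where
  "JH_quotient E F j = quot_lmod (E\<lparr>carrier := F j\<rparr>) (F (j - 1))"

definition JH_sequence ::
    "(ab_series, 'e) module \<Rightarrow> nat \<Rightarrow> (nat \<Rightarrow> 'e set) \<Rightarrow> bool" where
  "JH_sequence E k F \<longleftrightarrow> regular E \<and> has_rank E k \<and>
     F 0 = {\<zero>\<^bsub>E\<^esub>} \<and> F k = carrier E \<and>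
     (\<forall>j\<in>{0..k}. normal_submodule (F j) E) \<and>
     (\<forall>j\<in>{1..k}. F (j - 1) \<subseteq> F j \<and> has_rank (JH_quotient E F j) 1)"

text \<open>
  For a primitive geometric module the numbers \<open>\<lambda>\<^sub>j\<close> are rational; asking for real ones gives the order
  used in the monotonicity condition.
\<close>

definition principal_JH ::
    "(ab_series, 'e) module \<Rightarrow> nat \<Rightarrow> (nat \<Rightarrow> 'e set) \<Rightarrow> bool" where
  "principal_JH E k F \<longleftrightarrow> JH_sequence E k F \<and>
     (\<exists>l :: nat \<Rightarrow> real.
        (\<forall>j\<in>{1..k}. lmod_iso ab_algebra (JH_quotient E F j) (E_mod (of_real (l j)))) \<and>
        mono_on {1..k} (\<lambda>j. l j + real j))"

end

theory Submission
  imports Defs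
begin

text \<open>
  Let \<open>e\<close> generate \<open>E\<close>, and let \<open>\<phi> : E \<rightarrow> E\<^sub>\<mu>\<close> be a linear map such that \<open>\<phi> e\<close> has valuation \<open>p\<close> in \<open>b\<close>.
  If \<open>S\<close> is the image of \<open>e\<close> in \<open>E / F\<^sub>k\<^sub>-\<^sub>1 = E\<^sub>\<lambda>\<close>, \<open>\<lambda> = \<lambda>\<^sub>k\<close>, then \<open>S\<close> is invertible and
  \<open>(a - \<lambda> b) S\<^sup>-\<^sup>1 e\<close> generates \<open>F\<^sub>k\<^sub>-\<^sub>1\<close>; its image under \<open>\<phi>\<close> has leading term
  proportional to \<open>(p + \<mu> - \<lambda>) b\<^sup>p\<^sup>+\<^sup>1\<close>. Going down to \<open>F\<^sub>0 = 0\<close>, one gets \<open>\<lambda>\<^sub>j + j = \<mu> + p + k\<close> for some \<open>j\<close>,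
  so \<open>\<mu> + p \<le> \<lambda>\<^sub>k\<close> when the sequence is principal. For two principal sequences this forces equal
  last numbers (\<open>p = 0\<close>), and a combination of the two maps \<open>E \<rightarrow> E\<^sub>\<lambda>\<close> that kills the constant
  term of the image of \<open>e\<close> must vanish. Hence the maps are proportional, \<open>F\<^sub>k\<^sub>-\<^sub>1 = G\<^sub>k\<^sub>-\<^sub>1\<close>, and
  one concludes by induction on \<open>k\<close>.
\<close>

section \<open>Division by \<open>a - \<mu> b\<close>\<close>

definition a_minus_b :: "complex \<Rightarrow> ab_series" where
  "a_minus_b \<mu> = a_elt - ab_mult (scalar \<mu>) b_elt"

lemma b_series_diff: "b_series (s - t) = b_series s - b_series t"
  by (simp add: fps_eq_iff b_series_def)

lemma b_series_0 [simp]: "b_series 0 = 0"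
  by (simp add: fps_eq_iff b_series_def)

lemma b_series_1 [simp]: "b_series 1 = 1"
  by (simp add: fps_eq_iff b_series_def fps_one_nth)

lemma ab_mult_diff_left: "ab_mult (u - u') v = ab_mult u v - ab_mult u' v"
  using ab_mult_add_left[of "u - u'" u' v] by simp

lemma ab_mult_diff_right: "ab_mult u (v - v') = ab_mult u v - ab_mult u v'"
  using ab_mult_add_right[of u "v - v'" v'] by simp

text \<open>The coefficients of \<open>b_series s\<close> are constant polynomials, so every term
  with a derivative vanishes: multiplying by a series in \<open>b\<close> on the right is an
  ordinary Cauchy product.\<close>

lemma nth_mult_b_series:
  "fps_nth (ab_mult u (b_series s)) n = (\<Sum>i\<le>n. Polynomial.smult (fps_nth s (n - i)) (fps_nth u i))"
proof -
  have "(\<Sum>j\<le>n - i. Polynomial.smult ((- of_nat i) gchoose j)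
       (fps_nth u i * (pderiv ^^ j) (fps_nth (b_series s) (n - i - j)))) =
     (\<Sum>j\<le>n - i. if j = 0 then Polynomial.smult (fps_nth s (n - i)) (fps_nth u i) else 0)" for i
  proof (rule sum.cong, simp)
    fix j
    have "(pderiv ^^ j) [:c:] = 0" if "j \<noteq> 0" for c :: complex
      using that by (cases j) (simp_all add: funpow_Suc_right del: funpow.simps)
    then show "Polynomial.smult ((- of_nat i) gchoose j)
       (fps_nth u i * (pderiv ^^ j) (fps_nth (b_series s) (n - i - j))) =
      (if j = 0 then Polynomial.smult (fps_nth s (n - i)) (fps_nth u i) else 0)"
      by (simp add: b_series_def)
  qed
  then show ?thesis
    by (simp add: fps_nth_ab_mult)
qed

lemma b_series_mult: "ab_mult (b_series s) (b_series t) = b_series (s * t)"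
proof (rule fps_ext)
  fix n
  have "fps_nth (ab_mult (b_series s) (b_series t)) n = (\<Sum>i\<le>n. [:fps_nth s i * fps_nth t (n - i):])"
    unfolding nth_mult_b_series by (simp add: b_series_def mult.commute)
  also have "\<dots> = [:\<Sum>i\<le>n. fps_nth s i * fps_nth t (n - i):]"
    by (induction n) (simp_all add: sum_to_poly)
  also have "\<dots> = fps_nth (b_series (s * t)) n"
    by (simp add: b_series_def fps_mult_nth atLeast0AtMost)
  finally show "fps_nth (ab_mult (b_series s) (b_series t)) n = fps_nth (b_series (s * t)) n" .
qed

text \<open>From b^i a = a b^i - i b^(i+1) one gets P(a) b^i (a - \<mu> b) = a P(a) b^i - (i +
  \<mu>) P(a) b^(i+1). The term of index \<open>n\<close> therefore collects contributions from
  \<open>n\<close> and \<open>n - 1\<close> only.\<close>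

lemma nth_mult_a_minus_b:
  "fps_nth (ab_mult u (a_minus_b \<mu>)) n = [:0, 1:] * fps_nth u n -
     (if n = 0 then 0 else Polynomial.smult (of_nat (n - 1) + \<mu>) (fps_nth u (n - 1)))"
proof -
  have 1: "fps_nth (ab_mult u a_elt) n = [:0, 1:] * fps_nth u n -
     (if n = 0 then 0 else Polynomial.smult (of_nat (n - 1)) (fps_nth u (n - 1)))"
  proof -
    have "(\<Sum>j\<le>n - i. Polynomial.smult ((- of_nat i) gchoose j)
       (fps_nth u i * (pderiv ^^ j) (fps_nth a_elt (n - i - j)))) =
       (if i = n then [:0, 1:] * fps_nth u n else 0) +
       (if Suc i = n then - Polynomial.smult (of_nat (n - 1)) (fps_nth u (n - 1)) else 0)"
      if i: "i \<le> n" for i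
    proof -
      have "(\<Sum>j\<le>n - i. Polynomial.smult ((- of_nat i) gchoose j)
        (fps_nth u i * (pderiv ^^ j) (fps_nth a_elt (n - i - j)))) =
        (\<Sum>j\<le>n - i. if j = n - i then Polynomial.smult ((- of_nat i) gchoose (n - i))
          (fps_nth u i * (pderiv ^^ (n - i)) [:0, 1:]) else 0)"
        by (intro sum.cong) (auto simp: a_elt_monom nth_ab_monom)
      also have "\<dots> = Polynomial.smult ((- of_nat i) gchoose (n - i))
          (fps_nth u i * (pderiv ^^ (n - i)) [:0, 1:])"
        by simp
      also have "\<dots> = (if i = n then [:0, 1:] * fps_nth u n else 0) +
        (if Suc i = n then - Polynomial.smult (of_nat (n - 1)) (fps_nth u (n - 1)) else 0)"
      proof -
        \<comment> \<open>Only the zeroth and first derivatives of the polynomial x survive; the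
          latter carries the factor \<open>(- of_nat i) gchoose 1\<close>, which is -i.\<close>
        consider "n = i" | "n = Suc i" | d where "n = i + Suc (Suc d)"
          using i by (metis One_nat_def add.right_neutral add_Suc_right le_Suc_ex not0_implies_Suc)
        then show ?thesis
          by cases (auto simp: pderiv_pCons funpow_Suc_right simp del: funpow.simps)
      qed
      finally show ?thesis .
    qed
    then have "fps_nth (ab_mult u a_elt) n = (\<Sum>i\<le>n. (if i = n then [:0, 1:] * fps_nth u n else 0) +
       (if Suc i = n then - Polynomial.smult (of_nat (n - 1)) (fps_nth u (n - 1)) else 0))"
      by (simp add: fps_nth_ab_mult)
    also have "\<dots> = [:0, 1:] * fps_nth u n +
       (\<Sum>i\<le>n. if Suc i = n then - Polynomial.smult (of_nat (n - 1)) (fps_nth u (n - 1)) else 0)"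
      by (simp add: sum.distrib)
    also have "\<dots> = [:0, 1:] * fps_nth u n -
     (if n = 0 then 0 else Polynomial.smult (of_nat (n - 1)) (fps_nth u (n - 1)))"
      by (cases n) simp_all
    finally show ?thesis .
  qed
  have scalar_b: "ab_mult (scalar \<mu>) b_elt = b_series (fps_const \<mu> * fps_X)"
    by (simp add: scalar_def b_elt_def b_series_mult)
  have "fps_nth (fps_const \<mu> * fps_X) (n - i) = (if Suc i = n then \<mu> else 0)" if "i \<le> n" for i
    using that by (simp add: fps_X_def) linarith
  then have "fps_nth (ab_mult u (ab_mult (scalar \<mu>) b_elt)) n =
      (\<Sum>i\<le>n. if Suc i = n then Polynomial.smult \<mu> (fps_nth u (n - 1)) else 0)"
    unfolding scalar_b nth_mult_b_series by (intro sum.cong) auto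
  then have 2: "fps_nth (ab_mult u (ab_mult (scalar \<mu>) b_elt)) n =
     (if n = 0 then 0 else Polynomial.smult \<mu> (fps_nth u (n - 1)))"
    by (cases n) simp_all
  show ?thesis
    by (simp add: a_minus_b_def ab_mult_diff_right 1 2 smult_add_left)
qed

text \<open>Solves u = w (a - \<mu> b) + s for the coefficients of w, index by index.
  \<open>poly_shift 1\<close> is division by x; the constant terms left over are the coefficients of
  s.\<close>

primrec div_coeff :: "complex \<Rightarrow> ab_series \<Rightarrow> nat \<Rightarrow> complex poly" where
  "div_coeff \<mu> u 0 = poly_shift 1 (fps_nth u 0)"
| "div_coeff \<mu> u (Suc n) =
    poly_shift 1 (fps_nth u (Suc n) + Polynomial.smult (of_nat n + \<mu>) (div_coeff \<mu> u n))"

lemma poly_shift_1: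
  fixes p :: "'a :: comm_semiring_1 poly"
  shows "p = [:0, 1:] * poly_shift 1 p + [:coeff p 0:]"
proof (rule poly_eqI)
  fix n
  show "coeff p n = coeff ([:0, 1:] * poly_shift 1 p + [:coeff p 0:]) n"
    by (cases n) (simp_all add: coeff_poly_shift)
qed

lemma a_minus_b_division: "\<exists>w s. u = ab_mult w (a_minus_b \<mu>) + b_series s"
proof -
  define w where "w = Abs_fps (div_coeff \<mu> u)"
  define v where "v n = fps_nth u n + (if n = 0 then 0 else
     Polynomial.smult (of_nat (n - 1) + \<mu>) (fps_nth w (n - 1)))" for n
  have "fps_nth w n = poly_shift 1 (v n)" for n
    by (cases n) (simp_all add: w_def v_def)
  then have "v n = [:0, 1:] * fps_nth w n + [:coeff (v n) 0:]" for n
    using poly_shift_1[of "v n"] by simp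
  then have "fps_nth u n = fps_nth (ab_mult w (a_minus_b \<mu>) + b_series (Abs_fps (\<lambda>n. coeff (v n) 0))) n" for n
    using \<open>\<And>n. v n = [:0, 1:] * fps_nth w n + [:coeff (v n) 0:]\<close>[of n]
    by (simp add: nth_mult_a_minus_b b_series_def v_def algebra_simps)
  then show ?thesis
    by (metis fps_ext)
qed

text \<open>Uniqueness of the remainder: once coefficient n - 1 of \<open>w\<close> is zero, the
  equation at index n says that x times a polynomial is constant, so both vanish.\<close>

lemma mult_a_minus_b_eq_b_series:
  assumes "ab_mult w (a_minus_b \<mu>) = b_series s"
  shows "s = 0"
proof -
  have eq: "[:0, 1:] * fps_nth w n -
     (if n = 0 then 0 else Polynomial.smult (of_nat (n - 1) + \<mu>) (fps_nth w (n - 1))) = [:fps_nth s n:]" for n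
    unfolding nth_mult_a_minus_b[symmetric] by (simp add: assms b_series_def)
  have *: "q = 0 \<and> c = 0" if "[:0, 1:] * q = [:c:]" for q :: "complex poly" and c
    using that by simp
  have "fps_nth w n = 0 \<and> fps_nth s n = 0" for n
  proof (induction n)
    case 0
    show ?case using eq[of 0] by (intro *) simp
  next
    case (Suc n)
    show ?case using eq[of "Suc n"] Suc by (intro *) simp
  qed
  then show ?thesis
    by (simp add: fps_eq_iff)
qed

text \<open>The map \<open>u \<mapsto> residue \<mu> u\<close> identifies \<open>E\<^sub>\<mu>\<close> with the power series in \<open>b\<close>.\<close>

definition residue :: "complex \<Rightarrow> ab_series \<Rightarrow> complex fps" where
  "residue \<mu> u = (THE s. \<exists>w. u = ab_mult w (a_minus_b \<mu>) + b_series s)"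

lemma residue_eqI:
  assumes "u = ab_mult w (a_minus_b \<mu>) + b_series s"
  shows "residue \<mu> u = s"
  unfolding residue_def
proof (rule the_equality)
  show "\<exists>w. u = ab_mult w (a_minus_b \<mu>) + b_series s"
    using assms by blast
  fix t assume "\<exists>w. u = ab_mult w (a_minus_b \<mu>) + b_series t"
  then obtain w' where "u = ab_mult w' (a_minus_b \<mu>) + b_series t" ..
  with assms have "ab_mult (w' - w) (a_minus_b \<mu>) = b_series (s - t)"
    by (simp add: ab_mult_diff_left b_series_diff algebra_simps)
  then show "t = s"
    using mult_a_minus_b_eq_b_series by fastforce
qed

lemma residue_decomp: obtains w where "u = ab_mult w (a_minus_b \<mu>) + b_series (residue \<mu> u)"
  using a_minus_b_division residue_eqI by metis

section \<open>Rules for computing residues\<close>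

lemma residue_b_series [simp]: "residue \<mu> (b_series s) = s"
  by (rule residue_eqI[of _ 0]) simp

lemma residue_0 [simp]: "residue \<mu> 0 = 0"
  using residue_b_series[of \<mu> 0] by simp

lemma residue_diff: "residue \<mu> (u - v) = residue \<mu> u - residue \<mu> v"
proof -
  obtain w where w: "u = ab_mult w (a_minus_b \<mu>) + b_series (residue \<mu> u)"
    by (rule residue_decomp)
  obtain w' where w': "v = ab_mult w' (a_minus_b \<mu>) + b_series (residue \<mu> v)"
    by (rule residue_decomp)
  show ?thesis
    by (rule residue_eqI[of _ "w - w'"], subst w, subst w')
      (simp add: ab_mult_diff_left b_series_diff)
qed

lemma residue_eq_0_iff: "residue \<mu> u = 0 \<longleftrightarrow> (\<exists>w. u = ab_mult w (a_minus_b \<mu>))"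
  by (metis add.right_neutral b_series_0 residue_decomp residue_eqI)

text \<open>Multiples w (a - \<mu> b) form a left ideal, so multiplying by \<open>u\<close> on the
  left respects classes modulo it. The right-hand side is the action of \<open>u\<close> on the
  power series that represents the class of \<open>v\<close>.\<close>

lemma residue_mult: "residue \<mu> (ab_mult u v) = residue \<mu> (ab_mult u (b_series (residue \<mu> v)))"
proof -
  obtain w where w: "v = ab_mult w (a_minus_b \<mu>) + b_series (residue \<mu> v)"
    by (rule residue_decomp)
  have "ab_mult u v - ab_mult u (b_series (residue \<mu> v)) = ab_mult (ab_mult u w) (a_minus_b \<mu>)"
    by (subst w) (simp add: ab_mult_add_right ab_mult_assoc)
  then have "residue \<mu> (ab_mult u v - ab_mult u (b_series (residue \<mu> v))) = 0"
    using residue_eq_0_iff by blast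
  then show ?thesis
    by (simp add: residue_diff)
qed

text \<open>Constants are central in the algebra, unlike general series in \<open>b\<close>. This
  makes complex multiples of maps to the same \<open>E_mod \<mu>\<close> again linear.\<close>

lemma residue_const_mult: "residue \<mu> (ab_mult u (b_series (fps_const c * s))) =
    fps_const c * residue \<mu> (ab_mult u (b_series s))"
proof -
  have scalar: "ab_mult (b_series (fps_const c)) v = ab_mult v (b_series (fps_const c))" for v
  proof (rule fps_ext)
    fix n
    have "b_series (fps_const c) = ab_monom [:c:] 0"
      by (auto simp: b_series_def ab_monom_def fps_eq_iff)
    then have "fps_nth (ab_mult (b_series (fps_const c)) v) n =
       (\<Sum>j\<le>n. if j = 0 then Polynomial.smult c (fps_nth v n) else 0)"
      by (simp only: nth_monom_mult le0 if_True minus_nat.diff_0, intro sum.cong)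
        (auto simp: gbinomial_0_left)
    moreover have "fps_nth (ab_mult v (b_series (fps_const c))) n =
       (\<Sum>j\<le>n. if j = n then Polynomial.smult c (fps_nth v n) else 0)"
      unfolding nth_mult_b_series by (intro sum.cong) auto
    ultimately show "fps_nth (ab_mult (b_series (fps_const c)) v) n = fps_nth (ab_mult v (b_series (fps_const c))) n"
      by simp
  qed
  have "ab_mult u (b_series (fps_const c * s)) = ab_mult (b_series (fps_const c)) (ab_mult u (b_series s))"
    by (metis ab_mult_assoc b_series_mult scalar)
  then show ?thesis
    by (simp add: residue_mult[of \<mu> "b_series (fps_const c)"] b_series_mult)
qed

lemma residue_nth_0: "fps_nth (residue \<mu> u) 0 = coeff (fps_nth u 0) 0"
proof -
  obtain w where w: "u = ab_mult w (a_minus_b \<mu>) + b_series (residue \<mu> u)"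
    by (rule residue_decomp)
  have "coeff (fps_nth u 0) 0 = coeff (fps_nth (ab_mult w (a_minus_b \<mu>) + b_series (residue \<mu> u)) 0) 0"
    using w by simp
  then show ?thesis
    by (simp add: nth_mult_a_minus_b b_series_def)
qed

text \<open>Termwise, (a - \<nu> b) b^n = b^n (a - \<mu> b) + (n + \<mu> - \<nu>) b^(n+1), so
  \<open>b_series s\<close> itself is the quotient. The factor that can vanish at the leading term
  is what links valuations to the numbers of the sequence.\<close>

lemma residue_a_minus_b_mult:
  "residue \<mu> (ab_mult (a_minus_b \<nu>) (b_series s)) =
     fps_X * Abs_fps (\<lambda>n. (of_nat n + \<mu> - \<nu>) * fps_nth s n)"
proof (rule residue_eqI[of _ "b_series s"], rule fps_ext)
  fix n
  have a: "fps_nth (ab_mult a_elt (b_series s)) n = [:0, fps_nth s n:]"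
  proof -
    have "fps_nth (ab_mult a_elt (b_series s)) n = (\<Sum>i\<le>n. if i = 0 then [:0, fps_nth s n:] else 0)"
      unfolding nth_mult_b_series by (intro sum.cong) (auto simp: a_elt_def)
    then show ?thesis by simp
  qed
  have b: "ab_mult (ab_mult (scalar \<nu>) b_elt) (b_series s) = b_series (fps_const \<nu> * fps_X * s)"
    by (simp add: scalar_def b_elt_def b_series_mult)
  show "fps_nth (ab_mult (a_minus_b \<nu>) (b_series s)) n = fps_nth (ab_mult (b_series s) (a_minus_b \<mu>) +
      b_series (fps_X * Abs_fps (\<lambda>n. (of_nat n + \<mu> - \<nu>) * fps_nth s n))) n"
    unfolding a_minus_b_def[of \<nu>] ab_mult_diff_left b fps_sub_nth a fps_add_nth nth_mult_a_minus_b
    by (auto simp: b_series_def mult.assoc fps_X_mult_nth algebra_simps)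
qed


section \<open>Cosets in left modules\<close>

context left_module
begin

lemma coset_eq_iff:
  assumes "submodule N R M" "x \<in> carrier M" "y \<in> carrier M"
  shows "N +>\<^bsub>M\<^esub> x = N +>\<^bsub>M\<^esub> y \<longleftrightarrow> x \<ominus>\<^bsub>M\<^esub> y \<in> N"
proof -
  have N: "subgroup N (add_monoid M)"
    using assms(1) by (simp add: submodule_def)
  interpret S: abelian_subgroup N M
    by (rule abelian_subgroupI3[OF additive_subgroupI[OF N]]) unfold_locales
  show ?thesis
  proof
    assume "N +>\<^bsub>M\<^esub> x = N +>\<^bsub>M\<^esub> y"
    then have "x \<in> N +>\<^bsub>M\<^esub> y"
      using S.a_rcos_self assms by blast
    then show "x \<ominus>\<^bsub>M\<^esub> y \<in> N"
      using S.a_rcos_module assms by (simp add: a_minus_def)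
  next
    assume "x \<ominus>\<^bsub>M\<^esub> y \<in> N"
    then have "x \<in> N +>\<^bsub>M\<^esub> y"
      using S.a_rcos_module assms by (simp add: a_minus_def)
    then show "N +>\<^bsub>M\<^esub> x = N +>\<^bsub>M\<^esub> y"
      using M.a_repr_independence[OF _ assms(3) N] by simp
  qed
qed

lemma smult_r_minus:
  assumes "r \<in> carrier R" "x \<in> carrier M" "y \<in> carrier M"
  shows "r \<odot>\<^bsub>M\<^esub> (x \<ominus>\<^bsub>M\<^esub> y) = r \<odot>\<^bsub>M\<^esub> x \<ominus>\<^bsub>M\<^esub> r \<odot>\<^bsub>M\<^esub> y"
proof -
  have "r \<odot>\<^bsub>M\<^esub> (x \<ominus>\<^bsub>M\<^esub> y) \<oplus>\<^bsub>M\<^esub> r \<odot>\<^bsub>M\<^esub> y = r \<odot>\<^bsub>M\<^esub> (x \<ominus>\<^bsub>M\<^esub> y \<oplus>\<^bsub>M\<^esub> y)"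
    using assms by (simp add: smult_r_distr)
  also have "x \<ominus>\<^bsub>M\<^esub> y \<oplus>\<^bsub>M\<^esub> y = x"
    using assms by (simp add: a_minus_def M.a_assoc M.l_neg)
  finally show ?thesis
    using assms by (metis M.add.inv_solve_right M.minus_closed a_minus_def smult_closed)
qed

text \<open>The scalar product of \<open>quot_lmod\<close> is a union over all representatives; they
  all give the same coset, so the union collapses.\<close>

lemma smult_coset:
  assumes "submodule N R M" "r \<in> carrier R" "x \<in> carrier M"
  shows "(\<Union>y\<in>N +>\<^bsub>M\<^esub> x. N +>\<^bsub>M\<^esub> (r \<odot>\<^bsub>M\<^esub> y)) = N +>\<^bsub>M\<^esub> (r \<odot>\<^bsub>M\<^esub> x)"
proof -
  have N: "subgroup N (add_monoid M)"
    using assms(1) by (simp add: submodule_def)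
  interpret S: abelian_subgroup N M
    by (rule abelian_subgroupI3[OF additive_subgroupI[OF N]]) unfold_locales
  have self: "x \<in> N +>\<^bsub>M\<^esub> x"
    using S.a_rcos_self assms by blast
  have "N +>\<^bsub>M\<^esub> (r \<odot>\<^bsub>M\<^esub> y) = N +>\<^bsub>M\<^esub> (r \<odot>\<^bsub>M\<^esub> x)" if "y \<in> N +>\<^bsub>M\<^esub> x" for y
  proof -
    have y: "y \<in> carrier M"
      using that S.a_subset assms(3) M.a_r_coset_subset_G by blast
    have "y \<ominus>\<^bsub>M\<^esub> x \<in> N"
      using that S.a_rcos_module[OF assms(3) y] by (simp add: a_minus_def)
    then have "r \<odot>\<^bsub>M\<^esub> (y \<ominus>\<^bsub>M\<^esub> x) \<in> N"
      using submodule.smult_closed[OF assms(1,2)] by simp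
    then show ?thesis
      using assms y by (simp add: coset_eq_iff smult_r_minus)
  qed
  then show ?thesis
    using self by blast
qed

lemma zero_smult:
  assumes "x \<in> carrier M"
  shows "\<zero> \<odot>\<^bsub>M\<^esub> x = \<zero>\<^bsub>M\<^esub>"
proof -
  have "\<zero> \<odot>\<^bsub>M\<^esub> x \<oplus>\<^bsub>M\<^esub> \<zero> \<odot>\<^bsub>M\<^esub> x = \<zero> \<odot>\<^bsub>M\<^esub> x"
    using assms smult_l_distr[of \<zero> \<zero> x] by simp
  then show ?thesis
    using assms M.add.l_cancel_one' by (metis R.zero_closed smult_closed)
qed

end

lemma left_module_regular_lmod:
  assumes "ring R"
  shows "left_module R (regular_lmod R)"
proof -
  interpret ring R by fact
  have "abelian_group (regular_lmod R)"
  proof (rule abelian_groupI)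
    fix x assume "x \<in> carrier (regular_lmod R)"
    then show "\<exists>y\<in>carrier (regular_lmod R). y \<oplus>\<^bsub>regular_lmod R\<^esub> x = \<zero>\<^bsub>regular_lmod R\<^esub>"
      by (intro bexI[of _ "\<ominus>\<^bsub>R\<^esub> x"]) (auto simp: regular_lmod_def l_neg)
  qed (simp_all add: regular_lmod_def a_assoc, simp add: a_comm)
  then show ?thesis
    unfolding left_module_def left_module_axioms_def using assms
    by (auto simp: regular_lmod_def l_distr r_distr m_assoc)
qed

lemma a_minus_regular_ab_algebra:
  "u \<ominus>\<^bsub>ab_algebra\<^esub> v = u - v" "u \<ominus>\<^bsub>regular_lmod ab_algebra\<^esub> v = u - v"
proof -
  interpret A: ring ab_algebra by (rule ring_ab_algebra)
  interpret L: left_module ab_algebra "regular_lmod ab_algebra"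
    by (rule left_module_regular_lmod) (rule ring_ab_algebra)
  have "\<ominus>\<^bsub>ab_algebra\<^esub> v = - v"
    by (rule A.minus_equality) (simp_all add: ab_algebra_def)
  then show "u \<ominus>\<^bsub>ab_algebra\<^esub> v = u - v"
    by (simp add: a_minus_def ab_algebra_def)
  have "\<ominus>\<^bsub>regular_lmod ab_algebra\<^esub> v = - v"
    by (rule L.M.minus_equality) (simp_all add: regular_lmod_def ab_algebra_def)
  then show "u \<ominus>\<^bsub>regular_lmod ab_algebra\<^esub> v = u - v"
    by (simp add: a_minus_def regular_lmod_def ab_algebra_def)
qed


section \<open>Rank 1 quotients\<close>

text \<open>Maps to \<open>E\<^sub>\<mu>\<close> are read as maps to the power series in \<open>b\<close>; additivity is never needed.\<close>

definition functional ::
    "(ab_series, 'e) module \<Rightarrow> complex \<Rightarrow> 'e set \<Rightarrow> ('e \<Rightarrow> complex fps) \<Rightarrow> bool" where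
  "functional E \<mu> X \<phi> \<longleftrightarrow>
     (\<forall>x\<in>X. \<forall>u. \<phi> (u \<odot>\<^bsub>E\<^esub> x) = residue \<mu> (ab_mult u (b_series (\<phi> x))))"

text \<open>Encodes an isomorphism of X/N with \<open>E_mod \<mu>\<close> by the composite map from
  X, without mentioning cosets: its kernel is N and it is onto.\<close>

definition rank1_quotient ::
    "(ab_series, 'e) module \<Rightarrow> complex \<Rightarrow> 'e set \<Rightarrow> 'e set \<Rightarrow> ('e \<Rightarrow> complex fps) \<Rightarrow> bool" where
  "rank1_quotient E \<mu> N X \<phi> \<longleftrightarrow>
     functional E \<mu> X \<phi> \<and> N = {x \<in> X. \<phi> x = 0} \<and> \<phi> ` X = UNIV"

text \<open>Project to the quotient, apply the isomorphism, choose a representative in the algebra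
  and take its residue. The choice is harmless because the left ideal defining
  \<open>E_mod \<mu>\<close> is exactly the kernel of \<open>residue \<mu>\<close>.\<close>

lemma lmod_iso_E_mod_rank1_quotient:
  assumes E: "left_module ab_algebra E"
    and N: "submodule N ab_algebra E" and X: "submodule X ab_algebra E" and "N \<subseteq> X"
    and iso: "lmod_iso ab_algebra (quot_lmod (E\<lparr>carrier := X\<rparr>) N) (E_mod \<mu>)"
  shows "\<exists>\<phi>. rank1_quotient E \<mu> N X \<phi>"
proof -
  interpret E: left_module ab_algebra E by fact
  interpret A: left_module ab_algebra "regular_lmod ab_algebra"
    by (rule left_module_regular_lmod) (rule ring_ab_algebra)
  interpret X: submodule X ab_algebra E by fact
  let ?A = "regular_lmod ab_algebra" and ?Q = "quot_lmod (E\<lparr>carrier := X\<rparr>) N"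
  have U [simp]: "u \<in> carrier ab_algebra" "u \<in> carrier ?A" for u
    by (simp_all add: ab_algebra_def regular_lmod_def)
  have ops: "u \<odot>\<^bsub>?A\<^esub> v = ab_mult u v" "u \<oplus>\<^bsub>?A\<^esub> v = u + v" "\<zero>\<^bsub>?A\<^esub> = 0" for u v
    by (simp_all add: regular_lmod_def ab_algebra_def)
  define I where "I = {u. residue \<mu> u = 0}"
  have "(\<lambda>u. u \<otimes>\<^bsub>ab_algebra\<^esub> (a_elt \<ominus>\<^bsub>ab_algebra\<^esub> scalar \<mu> \<otimes>\<^bsub>ab_algebra\<^esub> b_elt)) ` UNIV = I"
    unfolding a_minus_regular_ab_algebra
    by (auto simp: I_def residue_eq_0_iff a_minus_b_def ab_algebra_def)
  then have E_mod: "E_mod \<mu> = quot_lmod ?A I"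
    by (simp add: E_mod_def)
  have I: "submodule I ab_algebra ?A"
  proof (intro submodule.intro submodule_axioms.intro A.M.add.subgroupI)
    fix u v assume "u \<in> I" "v \<in> I"
    \<comment> \<open>The sum is written as a double difference so that \<open>residue_diff\<close>
      applies.\<close>
    then have "residue \<mu> (u - (0 - v)) = 0"
      unfolding residue_diff by (simp add: I_def)
    then show "u \<oplus>\<^bsub>?A\<^esub> v \<in> I"
      by (simp add: I_def ops)
  next
    fix u assume "u \<in> I"
    have "\<ominus>\<^bsub>?A\<^esub> u = 0 - u"
      using a_minus_regular_ab_algebra(2)[of 0 u] by (simp add: a_minus_def ops)
    with \<open>u \<in> I\<close> show "\<ominus>\<^bsub>?A\<^esub> u \<in> I"
      by (simp only: I_def mem_Collect_eq residue_diff) simp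
  next
    fix r u assume "u \<in> I"
    then show "r \<odot>\<^bsub>?A\<^esub> u \<in> I"
      using residue_mult[of \<mu> r u] by (simp add: I_def ops)
  qed (auto simp: I_def intro: exI[of _ 0])
  have I_eq: "I +>\<^bsub>?A\<^esub> u = I +>\<^bsub>?A\<^esub> v \<longleftrightarrow> residue \<mu> u = residue \<mu> v" for u v
    using A.coset_eq_iff[OF I, of u v] by (simp add: a_minus_regular_ab_algebra I_def residue_diff)
  have I_carrier: "carrier (E_mod \<mu>) = range (\<lambda>u. I +>\<^bsub>?A\<^esub> u)"
    by (auto simp: E_mod quot_lmod_def A_RCOSETS_def' regular_lmod_def ab_algebra_def)
  have I_smult: "r \<odot>\<^bsub>E_mod \<mu>\<^esub> (I +>\<^bsub>?A\<^esub> u) = I +>\<^bsub>?A\<^esub> (ab_mult r u)" for r u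
    using A.smult_coset[OF I, of r u] by (simp add: E_mod quot_lmod_def ops)
  have XE: "x \<in> carrier E" if "x \<in> X" for x
    using that X.subset by auto
  have coset: "N +>\<^bsub>E\<lparr>carrier := X\<rparr>\<^esub> x = N +>\<^bsub>E\<^esub> x" for x
    by (simp add: a_r_coset_def')
  have Q_carrier: "carrier ?Q = (\<lambda>x. N +>\<^bsub>E\<^esub> x) ` X"
    by (auto simp: quot_lmod_def A_RCOSETS_def' coset)
  have Q_smult: "r \<odot>\<^bsub>?Q\<^esub> (N +>\<^bsub>E\<^esub> x) = N +>\<^bsub>E\<^esub> (r \<odot>\<^bsub>E\<^esub> x)" if "x \<in> X" for r x
    using E.smult_coset[OF N U(1) XE[OF that], of r] by (simp add: quot_lmod_def coset)
  obtain g where g: "g \<in> lmod_hom ab_algebra ?Q (E_mod \<mu>)" and bij: "bij_betw g (carrier ?Q) (carrier (E_mod \<mu>))"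
    using iso unfolding lmod_iso_def by blast
  have "\<exists>u. g (N +>\<^bsub>E\<^esub> x) = I +>\<^bsub>?A\<^esub> u" if "x \<in> X" for x
  proof -
    have "g (N +>\<^bsub>E\<^esub> x) \<in> carrier (E_mod \<mu>)"
      using bij that unfolding Q_carrier by (auto dest!: bij_betw_imp_surj_on)
    then show ?thesis
      unfolding I_carrier by auto
  qed
  then obtain h where h: "\<And>x. x \<in> X \<Longrightarrow> g (N +>\<^bsub>E\<^esub> x) = I +>\<^bsub>?A\<^esub> (h x)"
    by metis
  define \<phi> where "\<phi> x = residue \<mu> (h x)" for x
  have \<phi>_eq: "\<phi> x = \<phi> y \<longleftrightarrow> x \<ominus>\<^bsub>E\<^esub> y \<in> N" if "x \<in> X" "y \<in> X" for x y
  proof -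
    have "\<phi> x = \<phi> y \<longleftrightarrow> g (N +>\<^bsub>E\<^esub> x) = g (N +>\<^bsub>E\<^esub> y)"
      using that by (simp add: \<phi>_def h I_eq)
    also have "\<dots> \<longleftrightarrow> N +>\<^bsub>E\<^esub> x = N +>\<^bsub>E\<^esub> y"
      using bij_betw_imp_inj_on[OF bij] that by (auto simp: Q_carrier inj_on_def)
    finally show ?thesis
      using E.coset_eq_iff[OF N] XE that by simp
  qed
  have lin: "functional E \<mu> X \<phi>"
    unfolding functional_def
  proof (intro ballI allI)
    fix x u assume x: "x \<in> X"
    have "g (u \<odot>\<^bsub>?Q\<^esub> (N +>\<^bsub>E\<^esub> x)) = u \<odot>\<^bsub>E_mod \<mu>\<^esub> g (N +>\<^bsub>E\<^esub> x)"
      using g x by (auto simp: lmod_hom_def Q_carrier)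
    then have "I +>\<^bsub>?A\<^esub> (h (u \<odot>\<^bsub>E\<^esub> x)) = I +>\<^bsub>?A\<^esub> (ab_mult u (h x))"
      using x by (simp add: Q_smult h I_smult)
    then show "\<phi> (u \<odot>\<^bsub>E\<^esub> x) = residue \<mu> (ab_mult u (b_series (\<phi> x)))"
      unfolding I_eq \<phi>_def by (simp add: residue_mult[of _ u "h x"])
  qed
  have zero: "\<zero>\<^bsub>E\<^esub> \<in> X"
    using X.one_closed by simp
  \<comment> \<open>As \<open>functional\<close> only speaks of scalar multiplication, the value at
    zero is obtained by writing zero as a multiple by the scalar zero.\<close>
  have "\<phi> (\<zero>\<^bsub>ab_algebra\<^esub> \<odot>\<^bsub>E\<^esub> \<zero>\<^bsub>E\<^esub>) = residue \<mu> (ab_mult 0 (b_series (\<phi> \<zero>\<^bsub>E\<^esub>)))"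
    using lin zero by (simp add: functional_def ab_algebra_def)
  then have "\<phi> \<zero>\<^bsub>E\<^esub> = 0"
    by (simp add: E.zero_smult)
  moreover have "x \<ominus>\<^bsub>E\<^esub> \<zero>\<^bsub>E\<^esub> = x" if "x \<in> X" for x
    using XE[OF that] by (simp add: a_minus_def)
  ultimately have "\<phi> x = 0 \<longleftrightarrow> x \<in> N" if "x \<in> X" for x
    using \<phi>_eq[OF that zero] that by simp
  then have ker: "N = {x \<in> X. \<phi> x = 0}"
    using \<open>N \<subseteq> X\<close> by blast
  have "s \<in> \<phi> ` X" for s
  proof -
    have "I +>\<^bsub>?A\<^esub> (b_series s) \<in> g ` carrier ?Q"
      unfolding bij_betw_imp_surj_on[OF bij] I_carrier by blast
    then obtain x where x: "x \<in> X" "I +>\<^bsub>?A\<^esub> (b_series s) = I +>\<^bsub>?A\<^esub> (h x)"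
      unfolding Q_carrier by (auto simp: h)
    then have "s = \<phi> x"
      unfolding I_eq by (simp add: \<phi>_def)
    with x show ?thesis by blast
  qed
  with lin ker show ?thesis
    unfolding rank1_quotient_def by blast
qed

section \<open>Cyclic modules and their maps to rank 1 modules\<close>

definition cyclic :: "(ab_series, 'e) module \<Rightarrow> 'e \<Rightarrow> 'e set" where
  "cyclic E e = range (\<lambda>u. u \<odot>\<^bsub>E\<^esub> e)"

locale ab_left_module = left_module ab_algebra E for E :: "(ab_series, 'e) module" (structure)
begin

lemma smult_smult: "x \<in> carrier E \<Longrightarrow> u \<odot> (v \<odot> x) = ab_mult u v \<odot> x"
  using smult_assoc[of u v x] by (simp add: ab_algebra_def)

lemma one_smult: "x \<in> carrier E \<Longrightarrow> 1 \<odot> x = x"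
  using smult_one[of x] by (simp add: ab_algebra_def)

lemma smult_in_carrier: "x \<in> carrier E \<Longrightarrow> u \<odot> x \<in> carrier E"
  using smult_closed[of u x] by (simp add: ab_algebra_def)

lemma generator_in_cyclic: "e \<in> carrier E \<Longrightarrow> e \<in> cyclic E e"
  unfolding cyclic_def using one_smult[of e] by (metis rangeI)

lemma functional_cyclic:
  assumes "functional E \<mu> (cyclic E e) \<phi>" "e \<in> carrier E"
  shows "\<phi> (u \<odot> e) = residue \<mu> (ab_mult u (b_series (\<phi> e)))"
  using assms generator_in_cyclic unfolding functional_def by blast

text \<open>If the constant term were zero, then by \<open>residue_nth_0\<close> all values of
  \<open>\<phi>\<close> would have zero constant term, yet 1 is a value. Hence
  \<open>\<phi> e\<close> is invertible.\<close>

lemma rank1_quotient_generator_unit: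
  assumes "rank1_quotient E \<mu> N (cyclic E e) \<phi>" and e: "e \<in> carrier E"
  shows "fps_nth (\<phi> e) 0 \<noteq> 0"
proof
  assume 0: "fps_nth (\<phi> e) 0 = 0"
  have "1 \<in> \<phi> ` cyclic E e"
    using assms by (simp add: rank1_quotient_def)
  then obtain u where "1 = \<phi> (u \<odot> e)"
    by (auto simp: cyclic_def)
  then have "1 = residue \<mu> (ab_mult u (b_series (\<phi> e)))"
    using assms functional_cyclic by (simp add: rank1_quotient_def)
  then have "fps_nth 1 0 = coeff (fps_nth (ab_mult u (b_series (\<phi> e))) 0) 0"
    by (metis residue_nth_0)
  then show False
    by (simp add: nth_mult_b_series 0)
qed

text \<open>With S the image of \<open>e\<close>, the element v e is in the kernel iff v S is a left
  multiple of a - \<mu> b, that is, iff v is a left multiple of (a - \<mu> b) S^(-1). So the next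
  module down the chain is cyclic again.\<close>

lemma rank1_quotient_kernel_cyclic:
  assumes q: "rank1_quotient E \<mu> N (cyclic E e) \<phi>" and e: "e \<in> carrier E"
  shows "N = cyclic E (ab_mult (a_minus_b \<mu>) (b_series (inverse (\<phi> e))) \<odot> e)"
proof -
  define S where "S = \<phi> e"
  have "fps_nth S 0 \<noteq> 0"
    using rank1_quotient_generator_unit[OF assms] by (simp add: S_def)
  then have inv: "S * inverse S = 1" "inverse S * S = 1"
    by (simp_all add: inverse_mult_eq_1 inverse_mult_eq_1')
  let ?D = "ab_mult (a_minus_b \<mu>) (b_series (inverse S))"
  have N: "N = {x \<in> cyclic E e. \<phi> x = 0}" and f: "\<phi> (u \<odot> e) = residue \<mu> (ab_mult u (b_series S))" for u
    using q functional_cyclic[OF _ e, of \<mu> \<phi> u] by (auto simp: rank1_quotient_def S_def)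
  have "u \<odot> (?D \<odot> e) \<in> N" for u
  proof -
    have "ab_mult (ab_mult u ?D) (b_series S) = ab_mult u (a_minus_b \<mu>)"
      by (simp add: ab_mult_assoc b_series_mult inv ab_mult_1_right)
    then have "\<phi> (ab_mult u ?D \<odot> e) = 0"
      unfolding f residue_eq_0_iff by metis
    then show ?thesis
      unfolding N using e by (auto simp: smult_smult cyclic_def)
  qed
  moreover have "x \<in> cyclic E (?D \<odot> e)" if x: "x \<in> N" for x
  proof -
    obtain v where v: "x = v \<odot> e"
      using x by (auto simp: N cyclic_def)
    then have "residue \<mu> (ab_mult v (b_series S)) = 0"
      using x f by (simp add: N)
    then obtain w where w: "ab_mult v (b_series S) = ab_mult w (a_minus_b \<mu>)"
      using residue_eq_0_iff by blast
    have "v = ab_mult (ab_mult v (b_series S)) (b_series (inverse S))"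
      by (simp add: ab_mult_assoc b_series_mult inv ab_mult_1_right)
    also have "\<dots> = ab_mult w ?D"
      by (simp add: w ab_mult_assoc)
    finally have "x = w \<odot> (?D \<odot> e)"
      using v e by (simp add: smult_smult)
    then show ?thesis
      by (auto simp: cyclic_def)
  qed
  ultimately show ?thesis
    by (auto simp: cyclic_def S_def)
qed

text \<open>Passing from \<open>e\<close> to the generator of the kernel raises the valuation by one
  while the length drops by one, so their sum is unchanged, unless the leading factor p + \<mu> -
  \<nu> vanishes. It must vanish at some step, since no nonzero value is left on \<open>F 0\<close>;
  that step is the required index.\<close>

lemma functional_valuation:
  assumes "e \<in> carrier E" "F k = cyclic E e" "F 0 = {\<zero>}"
    and "\<forall>j\<in>{1..k}. rank1_quotient E (\<nu> j) (F (j - 1)) (F j) (f j)"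
    and "functional E \<mu> (F k) \<phi>" "\<phi> e \<noteq> 0"
  shows "\<exists>j\<in>{1..k}. \<nu> j + of_nat j = \<mu> + of_nat (subdegree (\<phi> e)) + of_nat k"
  using assms
proof (induction k arbitrary: e)
  case 0
  then have "e = \<zero>"
    using generator_in_cyclic[of e] by (metis singletonD)
  then have "\<phi> (0 \<odot> e) = \<phi> e"
    using 0 zero_smult[of e] by (simp add: ab_algebra_def)
  moreover have "\<phi> (0 \<odot> e) = 0"
    using 0 functional_cyclic[of \<mu> e \<phi> 0] by simp
  ultimately show ?case
    using 0 by simp
next
  case (Suc k)
  define p where "p = subdegree (\<phi> e)"
  have q: "rank1_quotient E (\<nu> (Suc k)) (F k) (cyclic E e) (f (Suc k))"
    using Suc.prems by (metis atLeastAtMost_iff diff_Suc_1 le_add1 order_refl plus_1_eq_Suc)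
  define S where "S = f (Suc k) e"
  have S: "fps_nth S 0 \<noteq> 0"
    using rank1_quotient_generator_unit[OF q] Suc.prems by (simp add: S_def)
  define e' where "e' = ab_mult (a_minus_b (\<nu> (Suc k))) (b_series (inverse S)) \<odot> e"
  have Fk: "F k = cyclic E e'"
    using rank1_quotient_kernel_cyclic[OF q] Suc.prems by (simp add: S_def e'_def)
  have e': "e' \<in> carrier E"
    using Suc.prems by (simp add: e'_def smult_in_carrier)
  define Q where "Q = inverse S * \<phi> e"
  \<comment> \<open>\<open>S\<close> is a unit, so multiplying by its inverse keeps the
    valuation.\<close>
  have "inverse S \<noteq> 0" "subdegree (inverse S) = 0"
    using S by (auto simp: subdegree_eq_0)
  then have Q: "subdegree Q = p" "Q \<noteq> 0"
    using Suc.prems by (simp_all add: Q_def p_def)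
  define R where "R = Abs_fps (\<lambda>n. (of_nat n + \<mu> - \<nu> (Suc k)) * fps_nth Q n)"
  have \<phi>e': "\<phi> e' = fps_X * R"
    using functional_cyclic[of \<mu> e \<phi>] Suc.prems
    by (simp add: e'_def ab_mult_assoc b_series_mult Q_def[symmetric] residue_a_minus_b_mult R_def)
  show ?case
  proof (cases "of_nat p + \<mu> = \<nu> (Suc k)")
    case True
    then show ?thesis
      by (intro bexI[of _ "Suc k"]) (simp_all add: p_def[symmetric] add_ac)
  next
    case False
    then have nz: "fps_nth R p \<noteq> 0"
      using Q nth_subdegree_nonzero[of Q] by (simp add: R_def)
    have "fps_nth R i = 0" if "i < p" for i
      using Q nth_less_subdegree_zero[of i Q] that by (simp add: R_def)
    with nz have R: "subdegree R = p"
      by (intro subdegreeI)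
    have "R \<noteq> 0"
      using nz by auto
    then have sub: "\<phi> e' \<noteq> 0" "subdegree (\<phi> e') = Suc p"
      by (simp_all add: \<phi>e' R)
    have "F k \<subseteq> F (Suc k)"
      using q Suc.prems by (auto simp: rank1_quotient_def)
    then have "functional E \<mu> (F k) \<phi>"
      using Suc.prems by (auto simp: functional_def)
    then have "\<exists>j\<in>{1..k}. \<nu> j + of_nat j = \<mu> + of_nat (subdegree (\<phi> e')) + of_nat k"
      using Suc.prems e' Fk sub by (intro Suc.IH) auto
    \<comment> \<open>The total is the desired one because Suc p + k = p + Suc k.\<close>
    then obtain j where j: "j \<in> {1..k}" "\<nu> j + of_nat j = \<mu> + of_nat (Suc p) + of_nat k"
      unfolding sub by blast
    then show ?thesis
      by (intro bexI[of _ j]) (auto simp: p_def)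
  qed
qed

text \<open>Monotonicity bounds the value at the index found in \<open>functional_valuation\<close>
  by the value at \<open>k\<close>; the terms in \<open>k\<close> then cancel.\<close>

lemma functional_valuation_bound:
  fixes \<nu> :: "nat \<Rightarrow> real" and \<mu> :: real
  assumes "e \<in> carrier E" "F k = cyclic E e" "F 0 = {\<zero>}"
    and "\<forall>j\<in>{1..k}. rank1_quotient E (\<nu> j) (F (j - 1)) (F j) (f j)"
    and "mono_on {1..k} (\<lambda>j. \<nu> j + real j)"
    and "functional E \<mu> (F k) \<phi>" "\<phi> e \<noteq> 0"
  shows "\<mu> + real (subdegree (\<phi> e)) \<le> \<nu> k"
proof -
  obtain j where j: "j \<in> {1..k}"
      "of_real (\<nu> j) + of_nat j = of_real \<mu> + of_nat (subdegree (\<phi> e)) + (of_nat k :: complex)"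
    using functional_valuation[of e F k "\<lambda>j. of_real (\<nu> j)" f "of_real \<mu>" \<phi>] assms by auto
  then have "of_real (\<nu> j + real j) = (of_real (\<mu> + real (subdegree (\<phi> e)) + real k) :: complex)"
    by simp
  then have "\<nu> j + real j = \<mu> + real (subdegree (\<phi> e)) + real k"
    by (simp only: of_real_eq_iff)
  moreover have "\<nu> j + real j \<le> \<nu> k + real k"
    using j by (intro mono_onD[OF assms(5)]) auto
  ultimately show ?thesis by simp
qed

lemma monotone_chain_unique:
  fixes \<nu> \<kappa> :: "nat \<Rightarrow> real"
  assumes "e \<in> carrier E" "F k = cyclic E e" "G k = cyclic E e" "F 0 = {\<zero>}" "G 0 = {\<zero>}"
    and "\<forall>j\<in>{1..k}. rank1_quotient E (\<nu> j) (F (j - 1)) (F j) (f j)"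
    and "\<forall>j\<in>{1..k}. rank1_quotient E (\<kappa> j) (G (j - 1)) (G j) (g j)"
    and "mono_on {1..k} (\<lambda>j. \<nu> j + real j)" "mono_on {1..k} (\<lambda>j. \<kappa> j + real j)"
  shows "\<forall>j\<in>{0..k}. F j = G j"
  using assms
proof (induction k arbitrary: e)
  case (Suc k)
  let ?\<phi> = "f (Suc k)" and ?\<psi> = "g (Suc k)"
  note e = \<open>e \<in> carrier E\<close>
  have qF: "rank1_quotient E (\<nu> (Suc k)) (F k) (cyclic E e) ?\<phi>"
    using bspec[OF Suc.prems(6), of "Suc k"] Suc.prems by simp
  have qG: "rank1_quotient E (\<kappa> (Suc k)) (G k) (cyclic E e) ?\<psi>"
    using bspec[OF Suc.prems(7), of "Suc k"] Suc.prems by simp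
  have \<phi>0: "fps_nth (?\<phi> e) 0 \<noteq> 0" and \<psi>0: "fps_nth (?\<psi> e) 0 \<noteq> 0"
    using rank1_quotient_generator_unit[OF qF e] rank1_quotient_generator_unit[OF qG e] .
  then have ne: "?\<phi> e \<noteq> 0" "?\<psi> e \<noteq> 0"
    by auto
  \<comment> \<open>Both chains end in \<open>cyclic E e\<close>, so each bound may be applied to
    the last map of the other chain, where the valuation is zero.\<close>
  note boundF = functional_valuation_bound[OF e Suc.prems(2,4,6,8), unfolded Suc.prems(2)]
  note boundG = functional_valuation_bound[OF e Suc.prems(3,5,7,9), unfolded Suc.prems(3)]
  have fF: "functional E (\<nu> (Suc k)) (cyclic E e) ?\<phi>" and fG: "functional E (\<kappa> (Suc k)) (cyclic E e) ?\<psi>"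
    using qF qG by (auto simp: rank1_quotient_def)
  have "\<kappa> (Suc k) \<le> \<nu> (Suc k)"
    using boundF[OF fG ne(2)] by simp
  moreover have "\<nu> (Suc k) \<le> \<kappa> (Suc k)"
    using boundG[OF fF ne(1)] by simp
  ultimately have eq: "\<kappa> (Suc k) = \<nu> (Suc k)" by simp
  \<comment> \<open>This ratio cancels the constant term of the image of \<open>e\<close>, so
    \<open>\<theta> e\<close> is either zero or of positive valuation; the bound excludes the
    latter.\<close>
  define c where "c = fps_nth (?\<psi> e) 0 / fps_nth (?\<phi> e) 0"
  define \<theta> where "\<theta> x = ?\<psi> x - fps_const c * ?\<phi> x" for x
  have f\<theta>: "functional E (\<nu> (Suc k)) (cyclic E e) \<theta>"
    using fF fG
    by (simp add: functional_def \<theta>_def eq b_series_diff ab_mult_diff_right residue_diff residue_const_mult)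
  have "\<theta> e = 0"
  proof (rule ccontr)
    assume nz: "\<theta> e \<noteq> 0"
    moreover have "fps_nth (\<theta> e) 0 = 0"
      using \<phi>0 by (simp add: \<theta>_def c_def)
    ultimately have "subdegree (\<theta> e) \<noteq> 0"
      by (simp add: subdegree_eq_0_iff)
    moreover have "\<nu> (Suc k) + real (subdegree (\<theta> e)) \<le> \<nu> (Suc k)"
      using f\<theta> nz by (rule boundF)
    ultimately show False by simp
  qed
  then have "\<theta> x = 0" if "x \<in> cyclic E e" for x
    using that functional_cyclic[OF f\<theta> e] by (auto simp: cyclic_def)
  then have "?\<psi> x = fps_const c * ?\<phi> x" if "x \<in> cyclic E e" for x
    using that by (simp add: \<theta>_def)
  moreover have "c \<noteq> 0"
    using \<phi>0 \<psi>0 by (simp add: c_def)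
  \<comment> \<open>Maps proportional by a nonzero constant have the same kernel.\<close>
  ultimately have FG: "F k = G k"
    using qF qG by (auto simp: rank1_quotient_def)
  \<comment> \<open>One element generates both \<open>F k\<close> and \<open>G k\<close>, as the
    induction hypothesis requires a common generator.\<close>
  define e' where "e' = ab_mult (a_minus_b (\<nu> (Suc k))) (b_series (inverse (?\<phi> e))) \<odot> e"
  have Fk: "F k = cyclic E e'"
    using rank1_quotient_kernel_cyclic[OF qF e] by (simp add: e'_def)
  have mono: "mono_on {1..k} h" if "mono_on {1..Suc k} h" for h :: "nat \<Rightarrow> real"
    using that by (rule mono_on_subset) auto
  have "\<forall>j\<in>{0..k}. F j = G j"
  proof (rule Suc.IH)
    show "e' \<in> carrier E"
      using e by (simp add: e'_def smult_in_carrier)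
    show "F k = cyclic E e'" "G k = cyclic E e'" "F 0 = {\<zero>}" "G 0 = {\<zero>}"
      using Fk FG Suc.prems(4,5) by simp_all
    show "\<forall>j\<in>{1..k}. rank1_quotient E (\<nu> j) (F (j - 1)) (F j) (f j)"
      "\<forall>j\<in>{1..k}. rank1_quotient E (\<kappa> j) (G (j - 1)) (G j) (g j)"
      using Suc.prems(6,7) by simp_all
    show "mono_on {1..k} (\<lambda>j. \<nu> j + real j)" "mono_on {1..k} (\<lambda>j. \<kappa> j + real j)"
      by (rule mono, fact Suc.prems)+
  qed
  moreover have "F (Suc k) = G (Suc k)"
    using Suc.prems(2,3) by simp
  ultimately show ?case
    by (auto simp: le_Suc_eq)
qed simp

end

section \<open>From principal Jordan-Hoelder sequences to chains of maps\<close>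

lemma principal_JH_chain:
  assumes "principal_JH E k F"
  obtains \<nu> :: "nat \<Rightarrow> real" and f where "F 0 = {\<zero>\<^bsub>E\<^esub>}" "F k = carrier E"
    "\<forall>j\<in>{1..k}. rank1_quotient E (\<nu> j) (F (j - 1)) (F j) (f j)"
    "mono_on {1..k} (\<lambda>j. \<nu> j + real j)"
proof -
  obtain \<nu> :: "nat \<Rightarrow> real" where J: "JH_sequence E k F"
    and iso: "\<forall>j\<in>{1..k}. lmod_iso ab_algebra (JH_quotient E F j) (E_mod (of_real (\<nu> j)))"
    and mono: "mono_on {1..k} (\<lambda>j. \<nu> j + real j)"
    using assms unfolding principal_JH_def by blast
  have E: "left_module ab_algebra E"
    using J by (simp add: JH_sequence_def regular_def ab_module_def)
  have "\<exists>\<phi>. rank1_quotient E (\<nu> j) (F (j - 1)) (F j) \<phi>" if j: "j \<in> {1..k}" for j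
  proof (rule lmod_iso_E_mod_rank1_quotient[OF E])
    have "j \<in> {0..k}" "j - 1 \<in> {0..k}"
      using j by auto
    then show "submodule (F (j - 1)) ab_algebra E" "submodule (F j) ab_algebra E"
      using J unfolding JH_sequence_def normal_submodule_def by blast+
    show "F (j - 1) \<subseteq> F j"
      using J j unfolding JH_sequence_def by blast
    show "lmod_iso ab_algebra (quot_lmod (E\<lparr>carrier := F j\<rparr>) (F (j - 1))) (E_mod (of_real (\<nu> j)))"
      using iso j by (simp add: JH_quotient_def)
  qed
  then obtain f where "\<forall>j\<in>{1..k}. rank1_quotient E (\<nu> j) (F (j - 1)) (F j) (f j)"
    by metis
  with J mono show ?thesis
    by (intro that[of \<nu> f]) (simp_all add: JH_sequence_def)
qed

theorem proposition1p2p5: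
  fixes E :: "(ab_series, 'e) module" and l :: rat
  assumes "0 < l" and "l \<le> 1"
    and "fresco E" and "primitive (of_rat l) E"
    and "principal_JH E k F" and "principal_JH E k G"
  shows "\<forall>j\<in>{0..k}. F j = G j"
proof -
  have "left_module ab_algebra E"
    using assms(3) by (simp add: fresco_def geometric_def regular_def ab_module_def)
  then interpret ab_left_module E
    by (rule ab_left_module.intro)
  obtain e where e: "e \<in> carrier E" "carrier E = cyclic E e"
    using assms(3) by (auto simp: fresco_def cyclic_def ab_algebra_def)
  obtain \<nu> f where F: "F 0 = {\<zero>\<^bsub>E\<^esub>}" "F k = carrier E"
    "\<forall>j\<in>{1..k}. rank1_quotient E (complex_of_real (\<nu> j)) (F (j - 1)) (F j) (f j)"
    "mono_on {1..k} (\<lambda>j. \<nu> j + real j)"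
    using principal_JH_chain[OF assms(5)] .
  obtain \<kappa> g where G: "G 0 = {\<zero>\<^bsub>E\<^esub>}" "G k = carrier E"
    "\<forall>j\<in>{1..k}. rank1_quotient E (complex_of_real (\<kappa> j)) (G (j - 1)) (G j) (g j)"
    "mono_on {1..k} (\<lambda>j. \<kappa> j + real j)"
    using principal_JH_chain[OF assms(6)] .
  show ?thesis
    using F(2) G(2) unfolding e(2)
    by (rule monotone_chain_unique[OF e(1) _ _ F(1) G(1) F(3) G(3) F(4) G(4)])
qed

end
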